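(* Let $d$ be a squarefree integer, $d\neq 0,1$, let $a,b\in\mathbb{Q}$, and let $p$ be a prime. Then: (a) If $p=2$: (i) if $Im\left((a+b\sqrt{d})^2\right)=0$ then $a=0$ or $b=0$; (ii) $Re\left((a+b\sqrt{d})^2\right)=0$ if and only if $a=\pm b$ and $d=-1$. (b) If $p=3$: (i) $Im\left((a+b\sqrt{d})^3\right)=0$ and $b\neq 0$ if and only if $a=\pm b$ and $d=-3$; (ii) $Re\left((a+b\sqrt{d})^3\right)=0$ and $a\neq 0$ if and only if $a=\pm 3b$ and $d=-3$. (c) If $p>3$: (i) $Im\left((a+b\sqrt{d})^p\right)=0$ if and only if $b=0$; (ii) $Re\left((a+b\sqrt{d})^p\right)=0$ if and only if $a=0$.
   Context: For an element $a+b\sqrt{d}$ of $K=\mathbb{Q}(\sqrt{d})$ with $a,b\in\mathbb{Q}$, its "real part" is $Re(a+b\sqrt{d})=a$ and its "imaginary part" is $Im(a+b\sqrt{d})=b$ (these are defined this way for every squarefree $d$, positive or negative).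
   Formalization: In (a)(ii), (b)(i) and (b)(ii) it is additionally assumed that a+b√d ≠ 0, since these equivalences fail at a=b=0 (for d ≠ -1 in (a)(ii), and for d = -3 in (b)). *)

theory Defs
  imports Complex_Main "HOL-Computational_Algebra.Computational_Algebra"
begin

text \<open>
  The field \<open>\<rat>(\<surd>d)\<close> is realised inside the complex numbers, with \<open>\<surd>d\<close> the principal
  square root, so \<open>\<surd>d = \<i> \<surd>\<bar>d\<bar>\<close> for \<open>d < 0\<close>. The rational coordinates \<open>qre\<close> and
  \<open>qim\<close> are not \<^const>\<open>Re\<close> and \<^const>\<open>Im\<close>: for instance \<open>qim 2 (csqrt 2) = 1\<close>.
\<close>

definition quad :: "int \<Rightarrow> rat \<Rightarrow> rat \<Rightarrow> complex" where
  "quad d a b = of_rat a + of_rat b * csqrt (of_int d)"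

definition quad_field :: "int \<Rightarrow> complex set" where
  "quad_field d = {quad d a b | a b. True}"

definition qre :: "int \<Rightarrow> complex \<Rightarrow> rat" where
  "qre d z = (THE a. \<exists>b. z = quad d a b)"

definition qim :: "int \<Rightarrow> complex \<Rightarrow> rat" where
  "qim d z = (THE b. \<exists>a. z = quad d a b)"

text \<open>For squarefree \<open>d \<noteq> 1\<close> the coordinates are unique, so the descriptions above are
  well defined on \<open>quad_field d\<close>, which is closed under powers.\<close>

lemma squarefree_not_rat_square:
  fixes c :: rat
  assumes "squarefree d" "d \<noteq> 1"
  shows "c\<^sup>2 \<noteq> of_int d"
proof
  assume eq: "c\<^sup>2 = of_int d"
  obtain m n where mn: "quotient_of c = (m, n)" by (cases "quotient_of c")
  have n: "n > 0" and cop: "coprime m n" and c: "c = of_int m / of_int n"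
    using mn by (auto intro: quotient_of_denom_pos quotient_of_coprime quotient_of_div)
  have "of_int m = c * of_int n"
    using n by (simp add: c)
  hence "(of_int m :: rat)\<^sup>2 = of_int d * (of_int n)\<^sup>2"
    by (simp only: power_mult_distrib eq)
  hence "(of_int (m\<^sup>2) :: rat) = of_int (d * n\<^sup>2)"
    by (simp only: of_int_mult of_int_power)
  hence *: "m\<^sup>2 = d * n\<^sup>2" by (simp only: of_int_eq_iff)
  have "n dvd d * n\<^sup>2"
    by (simp only: power2_eq_square) (intro dvd_mult dvd_refl)
  hence dvd: "n dvd m\<^sup>2" by (simp only: *)
  have "coprime (m\<^sup>2) n"
    unfolding power2_eq_square by (simp only: coprime_mult_left_iff cop)
  hence "is_unit n" by (rule coprime_common_divisor[OF _ dvd dvd_refl])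
  hence "n = 1" using n by (simp only: zdvd1_eq)
  hence d: "m\<^sup>2 = d" by (simp only: * power_one mult_1_right)
  hence "m\<^sup>2 dvd d" by (simp only: dvd_refl)
  hence "is_unit m" by (rule squarefreeD[OF assms(1)])
  hence "\<bar>m\<bar> = 1" by (simp only: zdvd1_eq)
  hence "m\<^sup>2 = 1" by (metis power2_abs power_one)
  thus False using d assms(2) by metis
qed

lemma quad_eq_iff:
  assumes "squarefree d" "d \<noteq> 1"
  shows "quad d a b = quad d a' b' \<longleftrightarrow> a = a' \<and> b = b'"
proof
  assume eq: "quad d a b = quad d a' b'"
  have "b = b'"
  proof (rule ccontr)
    assume ne: "b \<noteq> b'"
    define c where "c = (a' - a) / (b - b')"
    have "of_rat (b - b') * csqrt (of_int d) = of_rat (a' - a)"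
      using eq by (simp add: quad_def of_rat_diff algebra_simps)
    also have "a' - a = (b - b') * c"
      using ne by (simp add: c_def)
    finally have "csqrt (of_int d) = of_rat c"
      using ne by (simp only: of_rat_mult mult_cancel_left of_rat_eq_0_iff) simp
    hence "of_rat c ^ 2 = (of_int d :: complex)"
      by (metis power2_csqrt)
    hence "(of_rat (c\<^sup>2) :: complex) = of_rat (of_int d)"
      by (simp only: of_rat_power of_rat_of_int_eq)
    hence "c\<^sup>2 = of_int d"
      by (simp only: of_rat_eq_iff)
    thus False
      using squarefree_not_rat_square[OF assms] by blast
  qed
  thus "a = a' \<and> b = b'" using eq by (simp add: quad_def)
qed simp

lemma qre_quad: "squarefree d \<Longrightarrow> d \<noteq> 1 \<Longrightarrow> qre d (quad d a b) = a"
  and qim_quad: "squarefree d \<Longrightarrow> d \<noteq> 1 \<Longrightarrow> qim d (quad d a b) = b"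
  by (auto simp: qre_def qim_def quad_eq_iff)

lemma quad_mult:
  "quad d a b * quad d a' b' = quad d (a * a' + of_int d * b * b') (a * b' + a' * b)"
proof -
  have "quad d a b * quad d a' b' = of_rat a * of_rat a' + of_rat b * of_rat b' * (csqrt (of_int d))\<^sup>2
      + (of_rat a * of_rat b' + of_rat a' * of_rat b) * csqrt (of_int d)"
    by (simp add: quad_def power2_eq_square algebra_simps del: power2_csqrt)
  thus ?thesis by (simp add: quad_def of_rat_add of_rat_mult algebra_simps)
qed

lemma quad_power_in_quad_field: "quad d a b ^ n \<in> quad_field d"
proof (induction n)
  case 0
  have "1 = quad d 1 0" by (simp add: quad_def)
  thus ?case unfolding quad_field_def by auto
next
  case (Suc n)
  then obtain a' b' where "quad d a b ^ n = quad d a' b'"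
    by (auto simp: quad_field_def)
  hence "quad d a b ^ Suc n = quad d (a * a' + of_int d * b * b') (a * b' + a' * b)"
    by (simp add: quad_mult)
  thus ?case unfolding quad_field_def by blast
qed

end

theory Submission imports Defs begin

text \<open>
  If the imaginary part of \<open>z ^ p\<close> vanishes, the quotient \<open>w\<close> of \<open>z\<close> by its conjugate is a
  \<open>p\<close>-th root of unity whose trace \<open>w + 1 / w\<close> is rational. The trace is then an integer of absolute
  value at most 2, which forces \<open>w ^ 12 = 1\<close>; as \<open>p > 3\<close> is coprime to 12, \<open>w = 1\<close>.
  Multiplication by \<open>\<surd>d\<close> exchanges real and imaginary parts of odd powers up to a nonzero factor.
  For \<open>p \<le> 3\<close> the claims reduce to \<open>- d\<close> or \<open>- 3 d\<close> being a rational square.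
\<close>

section \<open>Conjugation in coordinates\<close>

text \<open>By \<open>quad_mult\<close>, negating both imaginary coordinates keeps the real
  coordinate of a product and negates the other one; uniqueness of coordinates carries this through
  the induction.\<close>

lemma quad_conj_power:
  "quad d a b ^ n = quad d A B \<Longrightarrow> squarefree d \<Longrightarrow> d \<noteq> 1 \<Longrightarrow> quad d a (- b) ^ n = quad d A (- B)"
proof (induction n arbitrary: A B)
  case 0
  have "quad d 1 0 = quad d A B" using 0(1) by (simp add: quad_def)
  hence "A = 1" "B = 0" using 0 by (simp_all add: quad_eq_iff)
  thus ?case by (simp add: quad_def)
next
  case (Suc n)
  obtain A' B' where AB: "quad d a b ^ n = quad d A' B'"
    using quad_power_in_quad_field[of d a b n] by (auto simp: quad_field_def)
  hence "quad d a (- b) ^ n = quad d A' (- B')" using Suc by blast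
  moreover have "quad d A B = quad d (a * A' + of_int d * b * B') (a * B' + A' * b)"
    using Suc.prems(1) AB by (simp add: quad_mult)
  ultimately show ?case
    using Suc.prems by (simp add: quad_mult quad_eq_iff)
qed

lemma quad_eq_0_iff:
  assumes "squarefree d" "d \<noteq> 1"
  shows "quad d a b = 0 \<longleftrightarrow> a = 0 \<and> b = 0"
proof -
  have "0 = quad d 0 0" by (simp add: quad_def)
  thus ?thesis using quad_eq_iff[OF assms, of a b 0 0] by simp
qed

text \<open>Clearing denominators in the recurrence \<open>V (k + 1) = t V k - V (k - 1)\<close> for \<open>V k = w ^ k + w ^ (- k)\<close>:
  the integers \<open>y ^ k V k\<close> are congruent to \<open>x ^ k\<close> modulo \<open>y\<close>.\<close>

lemma scaled_power_sum_cong: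
  fixes w v :: complex and x y :: int
  assumes "w * v = 1" and "of_int y * (w + v) = of_int x"
  shows "\<exists>U. of_int y ^ Suc k * (w ^ Suc k + v ^ Suc k) = of_int U \<and> y dvd U - x ^ Suc k"
proof -
  \<comment> \<open>The recurrence reaches two steps back, so integrality at \<open>k\<close> is
    carried along. The congruence starts at exponent 1: at exponent 0 the sum is 2, while
    \<open>x ^ 0\<close> is 1.\<close>
  have "(\<exists>U. of_int y ^ Suc k * (w ^ Suc k + v ^ Suc k) = of_int U \<and> y dvd U - x ^ Suc k)
      \<and> (\<exists>U'. of_int y ^ k * (w ^ k + v ^ k) = of_int U')"
  proof (induction k)
    case 0
    show ?case using assms(2) by (auto intro!: exI[of _ x] exI[of _ 2])
  next
    case (Suc k)
    then obtain U U' where U: "of_int y ^ Suc k * (w ^ Suc k + v ^ Suc k) = of_int U"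
      and dvd: "y dvd U - x ^ Suc k" and U': "of_int y ^ k * (w ^ k + v ^ k) = of_int U'"
      by blast
    have rec: "w ^ Suc (Suc k) + v ^ Suc (Suc k)
        = (w + v) * (w ^ Suc k + v ^ Suc k) - (w * v) * (w ^ k + v ^ k)"
      by (simp add: algebra_simps)
    have "of_int y ^ Suc (Suc k) * (w ^ Suc (Suc k) + v ^ Suc (Suc k))
        = (of_int y * (w + v)) * (of_int y ^ Suc k * (w ^ Suc k + v ^ Suc k))
          - of_int y ^ 2 * (of_int y ^ k * (w ^ k + v ^ k))"
      unfolding rec assms(1) by (simp add: algebra_simps power2_eq_square)
    also have "\<dots> = of_int (x * U - y\<^sup>2 * U')"
      unfolding U U' assms(2) by simp
    finally have "of_int y ^ Suc (Suc k) * (w ^ Suc (Suc k) + v ^ Suc (Suc k))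
      = of_int (x * U - y\<^sup>2 * U')" .
    moreover have "y dvd x * (U - x ^ Suc k) - y * (y * U')"
      by (rule dvd_diff[OF dvd_mult[OF dvd] dvd_triv_left])
    hence "y dvd (x * U - y\<^sup>2 * U') - x ^ Suc (Suc k)"
      by (simp add: algebra_simps power2_eq_square)
    ultimately show ?case using U by blast
  qed
  thus ?thesis by blast
qed

text \<open>For \<open>t = x / y\<close> in lowest terms, \<open>w ^ n = 1\<close> makes the scaled
  power sum equal to \<open>y ^ n * 2\<close>. Since it is congruent to \<open>x ^ n\<close> modulo
  \<open>y\<close>, the denominator \<open>y\<close> divides \<open>x ^ n\<close>, so
  \<open>y = 1\<close>.\<close>

lemma root_of_unity_trace_int:
  fixes w :: complex and t :: rat
  assumes "w ^ n = 1" "n > 0" and t: "w + inverse w = of_rat t"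
  shows "t \<in> \<int>"
proof -
  obtain x y where xy: "quotient_of t = (x, y)" by (cases "quotient_of t")
  have y: "y > 0" and cop: "coprime x y" and tq: "t = of_int x / of_int y"
    using xy by (auto intro: quotient_of_denom_pos quotient_of_coprime quotient_of_div)
  have w0: "w \<noteq> 0" using assms(1,2) by (auto simp: power_0_left)
  have "of_int y * (w + inverse w) = of_int x"
    unfolding t tq using y by (simp add: of_rat_divide)
  then obtain U where U: "of_int y ^ n * (w ^ n + inverse w ^ n) = of_int U" "y dvd U - x ^ n"
    using scaled_power_sum_cong[of w "inverse w" y x "n - 1"] w0 assms(2) by auto
  have "(of_int (y ^ n * 2) :: complex) = of_int U"
    using U(1) assms(1) by (simp add: power_inverse)
  hence "y ^ n * 2 = U" by (simp only: of_int_eq_iff)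
  hence "y dvd U" using assms(2) by (metis dvd_mult2 dvd_power)
  hence "y dvd x ^ n" using U(2) by (metis dvd_diffD1 dvd_diff_right_iff)
  moreover have "coprime (x ^ n) y" using cop by simp
  ultimately have "is_unit y" by (metis coprime_common_divisor dvd_refl)
  hence "y = 1" using y by (simp only: zdvd1_eq)
  thus ?thesis using tq by simp
qed

lemma coprime_roots_of_unity:
  fixes w :: complex
  assumes "w ^ m = 1" "w ^ n = 1" "coprime m n" "m > 0"
  shows "w = 1"
proof -
  obtain i j where "m * i = n * j + 1"
    using bezout_nat[of m n] assms by auto
  hence "(w ^ m) ^ i = (w ^ n) ^ j * w" by (simp flip: power_mult)
  thus ?thesis using assms by simp
qed

text \<open>For trace \<open>k\<close> equal to -2, -1, 0, 1, 2 the order of \<open>w\<close> is 2,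
  3, 4, 6, 1 respectively, and 12 is the least common multiple of these.\<close>

lemma root_of_unity_rat_trace_pow_12:
  fixes w :: complex and t :: rat
  assumes "w ^ n = 1" "n > 0" and t: "w + inverse w = of_rat t"
  shows "w ^ 12 = 1"
proof -
  obtain k where k: "t = of_int k"
    using root_of_unity_trace_int[OF assms] by (elim Ints_cases)
  have "norm w ^ n = 1 ^ n" using assms(1) by (metis norm_power norm_one power_one)
  hence nw: "norm w = 1" using assms(2) power_eq_iff_eq_base[of n "norm w" 1] by simp
  hence w0: "w \<noteq> 0" by auto
  have "norm (of_int k :: complex) \<le> norm w + norm (inverse w)"
    using t k norm_triangle_ineq[of w "inverse w"] by simp
  hence "\<bar>k\<bar> \<le> 2" using nw by (simp add: norm_inverse)
  hence "k \<in> {-2, -1, 0, 1, 2}" by auto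
  moreover have "w + inverse w = of_int k" using t k by simp
  hence eq: "w\<^sup>2 = of_int k * w - 1" using w0 by (simp add: field_simps power2_eq_square)
  ultimately consider "w\<^sup>2 = - 2 * w - 1" | "w\<^sup>2 = - w - 1" | "w\<^sup>2 = - 1"
    | "w\<^sup>2 = w - 1" | "w\<^sup>2 = 2 * w - 1"
    by fastforce
  thus ?thesis
  proof cases
    case 1
    hence "(w + 1)\<^sup>2 = 0" by (simp add: power2_sum)
    hence "w = -1" by (simp add: add_eq_0_iff2)
    thus ?thesis by simp
  next
    case h: 2
    have "w ^ 3 = w * w\<^sup>2" by (simp add: power3_eq_cube power2_eq_square)
    also have "\<dots> = w * (- w - 1)" by (simp only: h)
    also have "\<dots> = - w\<^sup>2 - w" by (simp add: power2_eq_square algebra_simps)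
    finally have "w ^ 3 = 1" by (simp add: h)
    hence "(w ^ 3) ^ 4 = 1" by simp
    thus ?thesis by (simp flip: power_mult)
  next
    case 3
    hence "(w\<^sup>2) ^ 6 = 1" by simp
    thus ?thesis by (simp flip: power_mult)
  next
    case h: 4
    have "w ^ 3 = w * w\<^sup>2" by (simp add: power3_eq_cube power2_eq_square)
    also have "\<dots> = w * (w - 1)" by (simp only: h)
    also have "\<dots> = w\<^sup>2 - w" by (simp add: power2_eq_square algebra_simps)
    finally have "w ^ 3 = -1" by (simp add: h)
    hence "(w ^ 3) ^ 4 = 1" by simp
    thus ?thesis by (simp flip: power_mult)
  next
    case 5
    hence "(w - 1)\<^sup>2 = 0" by (simp add: power2_diff)
    thus ?thesis by simp
  qed
qed

section \<open>Powers with exponent coprime to 12\<close>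

lemma qim_power_eq_0_iff:
  fixes a b :: rat
  assumes sf: "squarefree d" and d1: "d \<noteq> 1" and cop: "coprime n 12" and n: "n > 0"
  shows "qim d (quad d a b ^ n) = 0 \<longleftrightarrow> b = 0"
proof
  assume im: "qim d (quad d a b ^ n) = 0"
  show "b = 0"
  proof (rule ccontr)
    assume b: "b \<noteq> 0"
    define z z' where "z = quad d a b" and "z' = quad d a (- b)"
    have z0: "z \<noteq> 0" and z'0: "z' \<noteq> 0" using b by (auto simp: z_def z'_def quad_eq_0_iff[OF sf d1])
    obtain A B where AB: "z ^ n = quad d A B"
      using quad_power_in_quad_field[of d a b n] by (auto simp: quad_field_def z_def)
    \<comment> \<open>A power with zero imaginary coordinate is fixed by conjugation, so it equals
      the same power of \<open>z'\<close>.\<close>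
    with im have "B = 0" using qim_quad[OF sf d1] by (simp add: z_def)
    hence "z' ^ n = z ^ n"
      using quad_conj_power[of d a b n A B] AB sf d1 by (simp add: z_def z'_def)
    hence wn: "(z / z') ^ n = 1" using z0 by (simp add: power_divide)
    \<comment> \<open>\<open>N\<close> is the norm of \<open>z\<close> and \<open>T\<close> the
      trace of its square, so \<open>T / N\<close> is the trace of \<open>z / z'\<close>.\<close>
    define N where "N = a * a - of_int d * b * b"
    define T where "T = 2 * (a * a + of_int d * b * b)"
    have N: "z * z' = of_rat N" and T: "z * z + z' * z' = of_rat T"
      unfolding z_def z'_def quad_mult N_def T_def
      by (simp_all add: quad_def of_rat_add of_rat_diff of_rat_mult of_rat_minus algebra_simps)
    have "z / z' + inverse (z / z') = (z * z + z' * z') / (z * z')"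
      using z0 z'0 by (simp add: field_simps)
    hence "z / z' + inverse (z / z') = of_rat (T / N)"
      unfolding N T by (simp add: of_rat_divide)
    from root_of_unity_rat_trace_pow_12[OF wn n this]
    have "z / z' = 1" using coprime_roots_of_unity[OF wn _ cop n] by blast
    hence "z = z'" using z'0 by simp
    thus False using b by (simp add: z_def z'_def quad_eq_iff[OF sf d1])
  qed
next
  assume "b = 0"
  hence "quad d a b ^ n = quad d (a ^ n) 0" by (simp add: quad_def of_rat_power)
  thus "qim d (quad d a b ^ n) = 0" by (simp add: qim_quad[OF sf d1])
qed

lemma qre_power_eq_0_iff:
  fixes a b :: rat
  assumes sf: "squarefree d" and d0: "d \<noteq> 0" and d1: "d \<noteq> 1" and cop: "coprime n 12" and n: "n > 0"
  shows "qre d (quad d a b ^ n) = 0 \<longleftrightarrow> a = 0"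
proof -
  obtain A B where AB: "quad d a b ^ n = quad d A B"
    using quad_power_in_quad_field[of d a b n] by (auto simp: quad_field_def)
  have "odd n"
  proof
    assume "even n"
    hence "is_unit (2 :: nat)" by (intro coprime_common_divisor[OF cop]) auto
    thus False by simp
  qed
  then obtain m where m: "n = 2 * m + 1" by (elim oddE)
  \<comment> \<open>For odd \<open>n\<close> this power is \<open>d ^ m\<close> times the square
    root of \<open>d\<close>; multiplying by it moves \<open>A\<close> to the imaginary place,
    scaled by the nonzero \<open>d ^ m\<close>.\<close>
  have "quad d 0 1 ^ n = (csqrt (of_int d) ^ 2) ^ m * csqrt (of_int d)"
    by (simp add: quad_def m power_mult)
  hence s: "quad d 0 1 ^ n = quad d 0 (of_int d ^ m)"
    by (simp add: quad_def of_rat_power)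
  have "quad d (of_int d * b) a = quad d 0 1 * quad d a b" by (simp add: quad_mult)
  hence "quad d (of_int d * b) a ^ n = quad d 0 (of_int d ^ m) * quad d A B"
    by (simp add: power_mult_distrib s AB)
  hence "qim d (quad d (of_int d * b) a ^ n) = A * of_int d ^ m"
    by (simp add: quad_mult qim_quad[OF sf d1])
  moreover have "qre d (quad d a b ^ n) = A" by (simp add: AB qre_quad[OF sf d1])
  ultimately show ?thesis
    using qim_power_eq_0_iff[OF sf d1 cop n, of "of_int d * b" a] d0 by simp
qed

section \<open>Squares and cubes\<close>

lemma squarefree_neg_rat_square:
  fixes c :: rat
  assumes "squarefree d" "c\<^sup>2 = - of_int d"
  shows "d = -1"
  using squarefree_not_rat_square[of "- d" c] assms by auto

text \<open>If 3 does not divide \<open>d\<close>, then \<open>- (3 * d)\<close> is squarefree and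
  not 1, hence no rational square. If \<open>d = 3 * e\<close>, then \<open>c / 3\<close> has square
  \<open>- e\<close>, so \<open>e = -1\<close>.\<close>

lemma squarefree_neg_triple_rat_square:
  fixes c :: rat
  assumes sf: "squarefree d" and c: "c\<^sup>2 = - 3 * of_int d"
  shows "d = -3"
proof (cases "3 dvd d")
  case True
  then obtain e where e: "d = 3 * e" by blast
  have "squarefree e" by (rule squarefree_mono[OF _ sf]) (simp add: e)
  moreover have "(c / 3)\<^sup>2 = - of_int e" using c by (simp add: e power_divide)
  ultimately have "e = -1" by (rule squarefree_neg_rat_square)
  thus ?thesis using e by simp
next
  case False
  have p3: "prime (3 :: int)" by simp
  hence "coprime 3 d" using False by (rule prime_imp_coprime)
  hence "squarefree (3 * d)"
    using squarefree_mult_coprime[OF _ squarefree_prime[OF p3] sf] by blast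
  hence "squarefree (- (3 * d))" by simp
  moreover have "- (3 * d) \<noteq> 1" by presburger
  ultimately have "c\<^sup>2 \<noteq> of_int (- (3 * d))" by (rule squarefree_not_rat_square)
  with c show ?thesis by simp
qed

lemma quad_square:
  "quad d a b ^ 2 = quad d (a\<^sup>2 + of_int d * b\<^sup>2) (2 * a * b)"
  by (simp add: power2_eq_square quad_mult algebra_simps)

lemma quad_cube:
  "quad d a b ^ 3 = quad d (a * (a\<^sup>2 + 3 * of_int d * b\<^sup>2)) (b * (3 * a\<^sup>2 + of_int d * b\<^sup>2))"
proof -
  have "quad d a b ^ 3 = quad d a b * quad d a b ^ 2" by (simp add: eval_nat_numeral)
  thus ?thesis
    by (simp add: quad_square quad_mult) (simp add: power2_eq_square algebra_simps)
qed

text \<open>Dividing by \<open>b\<^sup>2\<close> makes \<open>- d\<close> the square of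
  \<open>a / b\<close>.\<close>

lemma squarefree_sum_squares_eq_0_iff:
  fixes a b :: rat
  assumes "squarefree d" "a \<noteq> 0 \<or> b \<noteq> 0"
  shows "a\<^sup>2 + of_int d * b\<^sup>2 = 0 \<longleftrightarrow> (a = b \<or> a = - b) \<and> d = -1"
proof
  assume eq: "a\<^sup>2 + of_int d * b\<^sup>2 = 0"
  hence b: "b \<noteq> 0" using assms(2) by auto
  have "(a / b)\<^sup>2 = - of_int d" using eq b by (simp add: field_simps eq_neg_iff_add_eq_0)
  hence "d = -1" by (rule squarefree_neg_rat_square[OF assms(1)])
  thus "(a = b \<or> a = - b) \<and> d = -1" using eq by (simp add: power2_eq_iff)
qed auto

lemma squarefree_triple_sum_squares_eq_0_iff:
  fixes a b :: rat
  assumes "squarefree d" "a \<noteq> 0 \<or> b \<noteq> 0"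
  shows "a\<^sup>2 + 3 * of_int d * b\<^sup>2 = 0 \<longleftrightarrow> (a = 3 * b \<or> a = - 3 * b) \<and> d = -3"
proof
  assume eq: "a\<^sup>2 + 3 * of_int d * b\<^sup>2 = 0"
  hence b: "b \<noteq> 0" using assms(2) by auto
  have "(a / b)\<^sup>2 = - 3 * of_int d" using eq b by (simp add: field_simps eq_neg_iff_add_eq_0)
  hence d: "d = -3" by (rule squarefree_neg_triple_rat_square[OF assms(1)])
  hence "a\<^sup>2 = (3 * b)\<^sup>2" using eq by (simp add: power_mult_distrib)
  thus "(a = 3 * b \<or> a = - 3 * b) \<and> d = -3" using d by (simp only: power2_eq_iff) simp
qed (auto simp: power_mult_distrib)

lemma prime_coprime_12:
  fixes p :: nat
  assumes "prime p" "p > 3"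
  shows "coprime p 12"
proof -
  have "\<not> p dvd 2" "\<not> p dvd 3" using assms(2) by (auto dest: dvd_imp_le)
  hence "\<not> p dvd 2 * 2 * 3" by (simp only: prime_dvd_mult_iff[OF assms(1)]) simp
  thus ?thesis by (intro prime_imp_coprime[OF assms(1)]) simp
qed

text \<open>The zero element is excluded from the equivalences for 2 and 3 that determine
  \<open>d\<close>: at \<open>a = b = 0\<close> the real part of the square vanishes for every
  \<open>d\<close>, and for \<open>d = -3\<close> the right-hand sides for the cube hold although
  \<open>a\<close> and \<open>b\<close> are zero.\<close>

theorem theorem3p10:
  fixes d :: int and a b :: rat and p :: nat
  assumes "squarefree d" and "d \<noteq> 0" and "d \<noteq> 1" and "prime p"
  shows
    "(p = 2 \<longrightarrow>
        (qim d (quad d a b ^ 2) = 0 \<longrightarrow> a = 0 \<or> b = 0) \<and>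
        (quad d a b \<noteq> 0 \<longrightarrow>
          (qre d (quad d a b ^ 2) = 0 \<longleftrightarrow> (a = b \<or> a = - b) \<and> d = -1)))
   \<and> (p = 3 \<longrightarrow> quad d a b \<noteq> 0 \<longrightarrow>
        (qim d (quad d a b ^ 3) = 0 \<and> b \<noteq> 0 \<longleftrightarrow> (a = b \<or> a = - b) \<and> d = -3) \<and>
        (qre d (quad d a b ^ 3) = 0 \<and> a \<noteq> 0 \<longleftrightarrow> (a = 3 * b \<or> a = - 3 * b) \<and> d = -3))
   \<and> (p > 3 \<longrightarrow>
        (qim d (quad d a b ^ p) = 0 \<longleftrightarrow> b = 0) \<and>
        (qre d (quad d a b ^ p) = 0 \<longleftrightarrow> a = 0))"
proof (intro conjI impI)
  note q = qre_quad[OF assms(1,3)] qim_quad[OF assms(1,3)] quad_eq_0_iff[OF assms(1,3)]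
  show "a = 0 \<or> b = 0" if "qim d (quad d a b ^ 2) = 0"
    using that by (simp add: quad_square q)
  show "qre d (quad d a b ^ 2) = 0 \<longleftrightarrow> (a = b \<or> a = - b) \<and> d = -1" if "quad d a b \<noteq> 0"
    using that squarefree_sum_squares_eq_0_iff[OF assms(1), of a b] by (simp add: quad_square q)
  show "qim d (quad d a b ^ 3) = 0 \<and> b \<noteq> 0 \<longleftrightarrow> (a = b \<or> a = - b) \<and> d = -3" if "quad d a b \<noteq> 0"
  proof -
    \<comment> \<open>Multiplying by 3 turns this factor of the imaginary coordinate into the one of
      the real coordinate, with \<open>3 * a\<close> for \<open>a\<close>.\<close>
    have "3 * a\<^sup>2 + of_int d * b\<^sup>2 = 0 \<longleftrightarrow> (3 * a)\<^sup>2 + 3 * of_int d * b\<^sup>2 = 0"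
      by (auto simp: power_mult_distrib)
    also have "\<dots> \<longleftrightarrow> (a = b \<or> a = - b) \<and> d = -3"
      using squarefree_triple_sum_squares_eq_0_iff[OF assms(1), of "3 * a" b] that by (auto simp: q)
    finally show ?thesis using that by (auto simp: quad_cube q)
  qed
  show "qre d (quad d a b ^ 3) = 0 \<and> a \<noteq> 0 \<longleftrightarrow> (a = 3 * b \<or> a = - 3 * b) \<and> d = -3"
    if "quad d a b \<noteq> 0"
    using squarefree_triple_sum_squares_eq_0_iff[OF assms(1), of a b] that
    by (auto simp: quad_cube q)
  show "qim d (quad d a b ^ p) = 0 \<longleftrightarrow> b = 0" if "p > 3"
    using qim_power_eq_0_iff[OF assms(1,3) prime_coprime_12[OF assms(4) that]] that by simp
  show "qre d (quad d a b ^ p) = 0 \<longleftrightarrow> a = 0" if "p > 3"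
    using qre_power_eq_0_iff[OF assms(1-3) prime_coprime_12[OF assms(4) that]] that by simp
qed

end
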